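(* Let $\alpha=\alpha(s)$ be a ccr-curve in $\mathrm{E}^4$, parameterized by arclength, with non-zero curvatures $\kappa(s)$, $\tau(s)=a\,\kappa(s)$ and $\sigma(s)=b\,\kappa(s)$, where $a,b$ are constants. Then: 1. $\alpha$ cannot be a generalized helix. 2. $\alpha$ cannot be a 3-type slant helix. 3. $\alpha$ lies on a hypersphere of radius $r$ in $\mathrm{E}^4$ if and only if $$f+\frac{(f')^{2}}{4a^2}+\frac{f}{4a^2b^2}\left(2a^2+f''\right)^2=r^2,$$ where $f=f(s)=\frac{1}{\kappa^2(s)}$.
   Context: $\mathrm{E}^4$ is $\mathbb{R}^4$ with its standard inner product. A unit speed curve $\alpha=\alpha(s)$ has Frenet-Serret frame $\{T,N,B,E\}$ (tangent, normal, binormal, trinormal; an orthonormal frame along $\alpha$ with $T=\alpha'$) and first, second and third curvatures $\kappa,\tau,\sigma$ satisfying $T'=\kappa N$, $N'=-\kappa T+\tau B$, $B'=-\tau N+\sigma E$, $E'=-\sigma B$. Primes denote derivatives with respect to $s$. A ccr-curve is a regular curve whose curvature ratios $\frac{\tau}{\kappa}$ and $\frac{\sigma}{\tau}$ are constant. A curve is a generalized helix if its tangent vector field $T$ makes a constant angle with a fixed unit vector $U$. A curve is a 3-type slant helix if its trinormal vector field $E$ makes a constant angle with a fixed direction (fixed unit vector) $U$.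
   Formalization: In item 3 the "if" direction is claimed only when the curve's interval is unbounded or 2a²+f'' is not identically zero; otherwise it fails, e.g. f = r²−a²s² on |s|<r/|a| satisfies the equation but the curve is not spherical. Curves are smooth on open intervals. *)

theory Defs
  imports "HOL-Analysis.Analysis"
begin

text \<open>
  Curves are defined on a nonempty open interval \<open>I\<close> (possibly unbounded, possibly all of
  \<open>\<real>\<close>); values of the functions outside \<open>I\<close> are irrelevant.
\<close>

definition smooth_on_open :: "real set \<Rightarrow> (real \<Rightarrow> 'a::real_normed_vector) \<Rightarrow> bool" where
  "smooth_on_open I g \<longleftrightarrow>
     (\<forall>n. ((\<lambda>h s. vector_derivative h (at s)) ^^ n) g differentiable_on I)"

definition orthonormal4 :: "real^4 \<Rightarrow> real^4 \<Rightarrow> real^4 \<Rightarrow> real^4 \<Rightarrow> bool" where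
  "orthonormal4 t n b e \<longleftrightarrow>
     norm t = 1 \<and> norm n = 1 \<and> norm b = 1 \<and> norm e = 1 \<and>
     t \<bullet> n = 0 \<and> t \<bullet> b = 0 \<and> t \<bullet> e = 0 \<and> n \<bullet> b = 0 \<and> n \<bullet> e = 0 \<and> b \<bullet> e = 0"

text \<open>
  Unit speed is contained in the definition: \<open>T\<close> is the velocity of \<open>\<alpha>\<close> and has norm 1.
  No sign is prescribed for the curvatures and no orientation for the frame.
  Smoothness of the frame and the curvatures is the usual standing convention; when the
  curvatures do not vanish it follows from smoothness of \<open>\<alpha>\<close>.
\<close>

definition unit_speed_frenet_curve ::
  "real set \<Rightarrow> (real \<Rightarrow> real^4) \<Rightarrow>
   (real \<Rightarrow> real^4) \<Rightarrow> (real \<Rightarrow> real^4) \<Rightarrow> (real \<Rightarrow> real^4) \<Rightarrow> (real \<Rightarrow> real^4) \<Rightarrow>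
   (real \<Rightarrow> real) \<Rightarrow> (real \<Rightarrow> real) \<Rightarrow> (real \<Rightarrow> real) \<Rightarrow> bool" where
  "unit_speed_frenet_curve I \<alpha> T N B E \<kappa> \<tau> \<sigma> \<longleftrightarrow>
     open I \<and> is_interval I \<and> I \<noteq> {} \<and>
     smooth_on_open I \<alpha> \<and>
     smooth_on_open I T \<and> smooth_on_open I N \<and> smooth_on_open I B \<and> smooth_on_open I E \<and>
     smooth_on_open I \<kappa> \<and> smooth_on_open I \<tau> \<and> smooth_on_open I \<sigma> \<and>
     (\<forall>s\<in>I.
        orthonormal4 (T s) (N s) (B s) (E s) \<and>
        (\<alpha> has_vector_derivative T s) (at s) \<and>
        (T has_vector_derivative \<kappa> s *\<^sub>R N s) (at s) \<and>
        (N has_vector_derivative - \<kappa> s *\<^sub>R T s + \<tau> s *\<^sub>R B s) (at s) \<and>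
        (B has_vector_derivative - \<tau> s *\<^sub>R N s + \<sigma> s *\<^sub>R E s) (at s) \<and>
        (E has_vector_derivative - \<sigma> s *\<^sub>R B s) (at s))"

text \<open>
  A pitfall: the ratios are only meaningful where \<open>\<kappa>\<close> and \<open>\<tau>\<close> do not vanish, since
  \<open>x / 0 = 0\<close>. Regularity is implied by unit speed.
\<close>

definition ccr_curve ::
  "real set \<Rightarrow> (real \<Rightarrow> real^4) \<Rightarrow>
   (real \<Rightarrow> real^4) \<Rightarrow> (real \<Rightarrow> real^4) \<Rightarrow> (real \<Rightarrow> real^4) \<Rightarrow> (real \<Rightarrow> real^4) \<Rightarrow>
   (real \<Rightarrow> real) \<Rightarrow> (real \<Rightarrow> real) \<Rightarrow> (real \<Rightarrow> real) \<Rightarrow> bool" where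
  "ccr_curve I \<alpha> T N B E \<kappa> \<tau> \<sigma> \<longleftrightarrow>
     unit_speed_frenet_curve I \<alpha> T N B E \<kappa> \<tau> \<sigma> \<and>
     (\<exists>c. \<forall>s\<in>I. \<tau> s / \<kappa> s = c) \<and>
     (\<exists>d. \<forall>s\<in>I. \<sigma> s / \<tau> s = d)"

definition vec_angle :: "'a::real_inner \<Rightarrow> 'a \<Rightarrow> real" where
  "vec_angle u v = arccos (u \<bullet> v / (norm u * norm v))"

definition constant_angle_with_fixed_direction ::
  "real set \<Rightarrow> (real \<Rightarrow> 'a::real_inner) \<Rightarrow> bool" where
  "constant_angle_with_fixed_direction I V \<longleftrightarrow>
     (\<exists>U. norm U = 1 \<and> (\<exists>\<theta>. \<forall>s\<in>I. vec_angle (V s) U = \<theta>))"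

text \<open>The first definition is to be applied to the tangent field of a curve, the second to its
  trinormal field.\<close>

definition generalized_helix :: "real set \<Rightarrow> (real \<Rightarrow> real^4) \<Rightarrow> bool" where
  "generalized_helix I T \<longleftrightarrow> constant_angle_with_fixed_direction I T"

definition slant_helix_type3 :: "real set \<Rightarrow> (real \<Rightarrow> real^4) \<Rightarrow> bool" where
  "slant_helix_type3 I E \<longleftrightarrow> constant_angle_with_fixed_direction I E"

definition on_hypersphere :: "real set \<Rightarrow> (real \<Rightarrow> real^4) \<Rightarrow> real \<Rightarrow> bool" where
  "on_hypersphere I \<alpha> r \<longleftrightarrow> (\<exists>m. \<alpha> ` I \<subseteq> sphere m r)"

end

theory Submission
  imports Defs
begin

text \<open>
  For the two negative statements, let \<open>T \<bullet> U\<close> be constant.  Differentiating it repeatedly with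
  the Frenet equations determines the other components of \<open>U\<close>: first \<open>N \<bullet> U = 0\<close>, then
  \<open>B \<bullet> U\<close> is constant because \<open>\<tau> / \<kappa>\<close> is, then \<open>E \<bullet> U = 0\<close>, and the last equation
  gives \<open>B \<bullet> U = 0\<close>.  Then also \<open>T \<bullet> U = a (B \<bullet> U) = 0\<close>, so \<open>U = 0\<close>.
  The argument for \<open>E \<bullet> U\<close> is the same with the Frenet equations used in reverse order.

  For the spheres, put \<open>f = 1 / \<kappa>\<^sup>2\<close> and let \<open>c\<^sub>N = 1 / \<kappa>\<close>,
  \<open>c\<^sub>B = f' / (2 a)\<close> and \<open>c\<^sub>E = (2 a\<^sup>2 + f'') / (2 a b \<kappa>)\<close>.  If \<open>\<alpha>\<close> lies on a sphere
  with center \<open>m\<close>, repeated differentiation of \<open>|\<alpha> - m|\<^sup>2\<close> shows that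
  \<open>m - \<alpha> = c\<^sub>N N + c\<^sub>B B + c\<^sub>E E\<close>.  The left side of the radius equation is
  \<open>c\<^sub>N\<^sup>2 + c\<^sub>B\<^sup>2 + c\<^sub>E\<^sup>2\<close>, so the equation says \<open>|m - \<alpha>|\<^sup>2 = r\<^sup>2\<close>.

  Conversely, the candidate center \<open>\<alpha> + c\<^sub>N N + c\<^sub>B B + c\<^sub>E E\<close> has derivative \<open>w E\<close> with
  \<open>w = c\<^sub>E' + b \<kappa> c\<^sub>B\<close>, and differentiating the radius equation gives only \<open>c\<^sub>E w = 0\<close>.
  This does not force \<open>w = 0\<close> when \<open>c\<^sub>E\<close> vanishes identically, that is, when
  \<open>f'' = - 2 a\<^sup>2\<close> throughout; but then \<open>f'\<close> is affine with nonzero slope, while the radius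
  equation bounds it, so \<open>I\<close> is bounded.  In all other cases \<open>w\<close> vanishes identically.  This
  needs an argument, since a product of two functions can vanish without either factor vanishing
  identically: lemma \<open>factor_vanishes_or_trivial\<close> shows by connectedness that this cannot happen
  here.
\<close>

section \<open>Orthonormal frames and derivatives along a curve\<close>

lemma orthonormal4_expansion:
  assumes "orthonormal4 t n b e"
  shows "x = (x \<bullet> t) *\<^sub>R t + (x \<bullet> n) *\<^sub>R n + (x \<bullet> b) *\<^sub>R b + (x \<bullet> e) *\<^sub>R e"
proof -
  have on: "t \<bullet> t = 1" "n \<bullet> n = 1" "b \<bullet> b = 1" "e \<bullet> e = 1"
    "t \<bullet> n = 0" "t \<bullet> b = 0" "t \<bullet> e = 0" "n \<bullet> b = 0" "n \<bullet> e = 0" "b \<bullet> e = 0"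
    using assms by (auto simp: orthonormal4_def norm_eq_1)
  then have on': "n \<bullet> t = 0" "b \<bullet> t = 0" "e \<bullet> t = 0" "b \<bullet> n = 0" "e \<bullet> n = 0" "e \<bullet> b = 0"
    by (auto simp: inner_commute)
  let ?S = "{t, n, b, e}"
  have distinct: "t \<noteq> n" "t \<noteq> b" "t \<noteq> e" "n \<noteq> b" "n \<noteq> e" "b \<noteq> e"
    using on by auto
  have nz: "0 \<notin> ?S"
    using on by auto
  have "pairwise orthogonal ?S"
    using on on' by (auto simp: pairwise_def orthogonal_def)
  then have "independent ?S"
    using nz by (rule pairwise_orthogonal_independent)
  moreover have "card ?S = DIM(real^4)"
    using distinct by simp
  ultimately have span: "span ?S = UNIV"
    using card_eq_dim[of ?S UNIV] by (auto simp: dim_UNIV)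
  define y where "y = x - ((x \<bullet> t) *\<^sub>R t + (x \<bullet> n) *\<^sub>R n + (x \<bullet> b) *\<^sub>R b + (x \<bullet> e) *\<^sub>R e)"
  have "orthogonal y z" if "z \<in> ?S" for z
    using that on on' by (auto simp: orthogonal_def y_def inner_diff_left inner_add_left)
  then have "orthogonal y y"
    using orthogonal_to_span[of y ?S y] span by auto
  then show ?thesis
    by (simp add: y_def orthogonal_self)
qed

lemma orthonormal4_Parseval:
  assumes "orthonormal4 t n b e"
  shows "x \<bullet> x = (x \<bullet> t)\<^sup>2 + (x \<bullet> n)\<^sup>2 + (x \<bullet> b)\<^sup>2 + (x \<bullet> e)\<^sup>2"
proof -
  have "x \<bullet> x = x \<bullet> ((x \<bullet> t) *\<^sub>R t + (x \<bullet> n) *\<^sub>R n + (x \<bullet> b) *\<^sub>R b + (x \<bullet> e) *\<^sub>R e)"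
    using orthonormal4_expansion[OF assms, of x] by simp
  then show ?thesis
    by (simp add: inner_add_right power2_eq_square)
qed

lemma has_real_derivative_inner:
  assumes "(f has_vector_derivative f') (at s)" and "(g has_vector_derivative g') (at s)"
  shows "((\<lambda>s. f s \<bullet> g s) has_real_derivative f s \<bullet> g' + f' \<bullet> g s) (at s)"
  unfolding has_real_derivative_iff_has_vector_derivative
  using bounded_bilinear.has_vector_derivative[OF bounded_bilinear_inner assms] .

lemma DERIV_unique_on_open:
  fixes f g :: "real \<Rightarrow> real"
  assumes "open S" "s \<in> S" "\<And>x. x \<in> S \<Longrightarrow> f x = g x"
    and "(f has_real_derivative D) (at s)" "(g has_real_derivative D') (at s)"
  shows "D = D'"
  using has_field_derivative_transform_within_open[OF assms(4,1,2,3)] assms(5)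
  by (rule DERIV_unique)

lemma smooth_on_open_has_derivative:
  fixes g :: "real \<Rightarrow> real"
  assumes "smooth_on_open S g" "open S" "s \<in> S"
  defines "D \<equiv> \<lambda>n. ((\<lambda>h s. vector_derivative h (at s)) ^^ n) g"
  shows "(D n has_real_derivative D (Suc n) s) (at s)"
proof -
  have "D n differentiable (at s)"
    using assms by (auto simp: smooth_on_open_def D_def differentiable_on_eq_differentiable_at)
  then show ?thesis
    by (simp add: has_real_derivative_iff_has_vector_derivative D_def vector_derivative_works)
qed

text \<open>
  Between unit vectors the angle determines the inner product, since the argument of \<open>arccos\<close>
  then lies in \<open>[-1, 1]\<close>.
\<close>

lemma constant_angle_imp_constant_inner:
  assumes "constant_angle_with_fixed_direction S V" "\<And>s. s \<in> S \<Longrightarrow> norm (V s) = 1"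
  obtains U c where "norm U = 1" "\<And>s. s \<in> S \<Longrightarrow> V s \<bullet> U = c"
proof -
  obtain U \<theta> where U: "norm U = 1" "\<And>s. s \<in> S \<Longrightarrow> vec_angle (V s) U = \<theta>"
    using assms(1) by (auto simp: constant_angle_with_fixed_direction_def)
  have "V s \<bullet> U = cos \<theta>" if "s \<in> S" for s
  proof -
    have "\<bar>V s \<bullet> U\<bar> \<le> 1"
      using Cauchy_Schwarz_ineq2[of "V s" U] U(1) assms(2)[OF that] by simp
    then have "cos (arccos (V s \<bullet> U)) = V s \<bullet> U"
      by (simp add: cos_arccos abs_le_iff)
    then show ?thesis
      using U(1) U(2)[OF that] assms(2)[OF that] by (simp add: vec_angle_def)
  qed
  with U(1) show ?thesis
    by (rule that)
qed

section \<open>A rigidity lemma for one scalar equation\<close>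

text \<open>
  Let \<open>w = h1 + b \<kappa> q\<close>.  The idea is that the set \<open>A\<close> of points where \<open>h\<close> vanishes together
  with its first two derivatives \<open>h1\<close> and \<open>h2\<close> is closed and open in
  \<open>I\<close>.  It is open because near each of its points \<open>w\<close> can vanish at most at the point itself, so that \<open>h w = 0\<close> forces \<open>h = 0\<close>
  nearby: if \<open>w = 0\<close> at a point of \<open>A\<close>, then \<open>q = 0\<close> there, hence
  \<open>w' = h2 + b \<kappa> q' = - a b \<kappa> \<noteq> 0\<close>.  On the other hand \<open>w \<noteq> 0\<close> at a point forces
  \<open>h = 0\<close> around it, so that the point belongs to \<open>A\<close>.  Hence either \<open>A = I\<close> and
  \<open>h = 0\<close>, or \<open>A\<close> is empty and \<open>w = 0\<close>.
\<close>

lemma factor_vanishes_or_trivial: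
  fixes h h1 h2 \<kappa> q :: "real \<Rightarrow> real"
  assumes I: "open I" "connected I"
    and h: "\<And>s. s \<in> I \<Longrightarrow> (h has_real_derivative h1 s) (at s)"
    and h1: "\<And>s. s \<in> I \<Longrightarrow> (h1 has_real_derivative h2 s) (at s)"
    and h2: "continuous_on I h2"
    and \<kappa>: "\<And>s. s \<in> I \<Longrightarrow> \<kappa> differentiable (at s)" "\<And>s. s \<in> I \<Longrightarrow> \<kappa> s \<noteq> 0"
    and q: "\<And>s. s \<in> I \<Longrightarrow> (q has_real_derivative b * \<kappa> s * h s - a) (at s)"
    and ab: "a \<noteq> 0" "b \<noteq> 0"
    and prod: "\<And>s. s \<in> I \<Longrightarrow> h s * (h1 s + b * \<kappa> s * q s) = 0"
  shows "(\<forall>s\<in>I. h s = 0) \<or> (\<forall>s\<in>I. h1 s + b * \<kappa> s * q s = 0)"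
proof -
  define w where "w = (\<lambda>s. h1 s + b * \<kappa> s * q s)"
  define A where "A = {s \<in> I. h s = 0 \<and> h1 s = 0 \<and> h2 s = 0}"
  have A_if_locally_0: "s \<in> A" if "open S" "S \<subseteq> I" "s \<in> S" "\<And>x. x \<in> S \<Longrightarrow> h x = 0" for s S
  proof -
    have 1: "h1 x = 0" if "x \<in> S" for x
      using DERIV_unique_on_open[OF \<open>open S\<close> that, of h "\<lambda>_. 0" "h1 x" 0] h[of x]
        \<open>S \<subseteq> I\<close> \<open>x \<in> S\<close> \<open>\<And>x. x \<in> S \<Longrightarrow> h x = 0\<close> by auto
    have "h2 x = 0" if "x \<in> S" for x
      using DERIV_unique_on_open[OF \<open>open S\<close> that, of h1 "\<lambda>_. 0" "h2 x" 0] h1[of x] 1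
        \<open>S \<subseteq> I\<close> \<open>x \<in> S\<close> by auto
    with 1 that show ?thesis
      by (auto simp: A_def)
  qed
  have w_cont: "isCont w s" if "s \<in> I" for s
    unfolding w_def using DERIV_isCont[OF h1[OF that]] DERIV_isCont[OF q[OF that]]
      differentiable_imp_continuous_within[OF \<kappa>(1)[OF that]] by (intro continuous_intros) auto
  have h_0: "h s = 0" if "s \<in> I" "w s \<noteq> 0" for s
    using prod[OF that(1)] that(2) by (auto simp: w_def)
  have nhd: "\<exists>S. open S \<and> s \<in> S \<and> S \<subseteq> I \<and> (\<forall>x\<in>S. h x = 0)"
    if "s \<in> I" and near: "\<forall>\<^sub>F x in at s. w x \<noteq> 0" and "h s = 0" for s
  proof -
    have "\<forall>\<^sub>F x in nhds s. x \<noteq> s \<longrightarrow> w x \<noteq> 0"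
      using near by (simp add: eventually_at_filter)
    moreover have "\<forall>\<^sub>F x in nhds s. x \<in> I"
      using I(1) \<open>s \<in> I\<close> by (rule eventually_nhds_in_open)
    ultimately have "\<forall>\<^sub>F x in nhds s. x \<in> I \<and> h x = 0"
      by eventually_elim (use h_0 \<open>h s = 0\<close> in auto)
    then show ?thesis
      by (auto simp: eventually_nhds)
  qed
  have nonzero_nhd: "\<forall>\<^sub>F x in at s. w x \<noteq> 0" if "s \<in> I" "w s \<noteq> 0" for s
    using w_cont[OF that(1)] that(2)
    unfolding isCont_def by (rule tendsto_imp_eventually_ne)
  have A_nhd: "\<exists>S. open S \<and> s \<in> S \<and> S \<subseteq> A" if "s \<in> A" for s
  proof -
    have s: "s \<in> I" "h s = 0" "h1 s = 0" "h2 s = 0"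
      using that by (auto simp: A_def)
    have "\<forall>\<^sub>F x in at s. w x \<noteq> 0"
    proof (cases "w s = 0")
      case False
      then show ?thesis
        using nonzero_nhd s(1) by blast
    next
      case True
      then have q0: "q s = 0"
        using s ab \<kappa>(2) by (auto simp: w_def)
      obtain \<kappa>' where \<kappa>': "(\<kappa> has_real_derivative \<kappa>') (at s)"
        using \<kappa>(1)[OF s(1)] by (auto simp: real_differentiable_def)
      have "(w has_real_derivative - a * b * \<kappa> s) (at s)"
        unfolding w_def using s q0
        by (auto intro!: derivative_eq_intros h1 q \<kappa>' simp: algebra_simps)
      then have "((\<lambda>x. (w x - w s) / (x - s)) \<longlongrightarrow> - a * b * \<kappa> s) (at s)"
        by (simp add: has_field_derivative_iff)
      then have "\<forall>\<^sub>F x in at s. (w x - w s) / (x - s) \<noteq> 0"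
        by (rule tendsto_imp_eventually_ne) (use ab \<kappa>(2) s in auto)
      then show ?thesis
        by eventually_elim (use True in auto)
    qed
    from nhd[OF s(1) this s(2)] obtain S where
      "open S" "s \<in> S" "S \<subseteq> I" "\<forall>x\<in>S. h x = 0" by blast
    with A_if_locally_0[of S] show ?thesis
      by blast
  qed
  have "open A"
    using A_nhd by (subst open_subopen) blast
  then have "openin (top_of_set I) A"
    by (auto simp: A_def openin_open)
  moreover have "closedin (top_of_set I) A"
  proof -
    have "continuous_on I h" "continuous_on I h1"
      using h h1 DERIV_isCont continuous_at_imp_continuous_on by blast+
    then have "closedin (top_of_set I) ({s \<in> I. h s = 0} \<inter> {s \<in> I. h1 s = 0} \<inter> {s \<in> I. h2 s = 0})"
      using h2 by (intro closedin_Int continuous_closedin_preimage_constant)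
    moreover have "{s \<in> I. h s = 0} \<inter> {s \<in> I. h1 s = 0} \<inter> {s \<in> I. h2 s = 0} = A"
      by (auto simp: A_def)
    ultimately show ?thesis
      by simp
  qed
  ultimately have "A = {} \<or> A = I"
    using I(2) by (auto simp: connected_clopen)
  then show ?thesis
  proof
    assume "A = I"
    then show ?thesis
      by (auto simp: A_def)
  next
    assume "A = {}"
    have "w s = 0" if s: "s \<in> I" for s
    proof (rule ccontr)
      assume w: "w s \<noteq> 0"
      obtain S where "open S" "s \<in> S" "S \<subseteq> I" "\<forall>x\<in>S. h x = 0"
        using nhd[OF s nonzero_nhd[OF s w] h_0[OF s w]] by blast
      then have "s \<in> A"
        using A_if_locally_0 by blast
      with \<open>A = {}\<close> show False
        by blast
    qed
    then show ?thesis
      by (simp add: w_def)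
  qed
qed

section \<open>Constant-ratio curves and fixed directions\<close>

locale ccr_frenet =
  fixes I :: "real set"
    and \<alpha> T N B E :: "real \<Rightarrow> real^4"
    and \<kappa> :: "real \<Rightarrow> real"
    and a b :: real
  assumes I: "open I" "connected I" "I \<noteq> {}"
    and a0: "a \<noteq> 0" and b0: "b \<noteq> 0"
    and \<kappa>_smooth: "smooth_on_open I \<kappa>"
    and \<kappa>0: "s \<in> I \<Longrightarrow> \<kappa> s \<noteq> 0"
    and frame: "s \<in> I \<Longrightarrow> orthonormal4 (T s) (N s) (B s) (E s)"
    and \<alpha>': "s \<in> I \<Longrightarrow> (\<alpha> has_vector_derivative T s) (at s)"
    and T': "s \<in> I \<Longrightarrow> (T has_vector_derivative \<kappa> s *\<^sub>R N s) (at s)"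
    and N': "s \<in> I \<Longrightarrow> (N has_vector_derivative - \<kappa> s *\<^sub>R T s + (a * \<kappa> s) *\<^sub>R B s) (at s)"
    and B': "s \<in> I \<Longrightarrow> (B has_vector_derivative - (a * \<kappa> s) *\<^sub>R N s + (b * \<kappa> s) *\<^sub>R E s) (at s)"
    and E': "s \<in> I \<Longrightarrow> (E has_vector_derivative - (b * \<kappa> s) *\<^sub>R B s) (at s)"
begin

lemma inner_frame_derivatives:
  assumes "s \<in> I"
  shows "((\<lambda>s. T s \<bullet> U) has_real_derivative \<kappa> s * (N s \<bullet> U)) (at s)"
    and "((\<lambda>s. N s \<bullet> U) has_real_derivative - \<kappa> s * (T s \<bullet> U) + a * \<kappa> s * (B s \<bullet> U)) (at s)"
    and "((\<lambda>s. B s \<bullet> U) has_real_derivative - (a * \<kappa> s) * (N s \<bullet> U) + b * \<kappa> s * (E s \<bullet> U)) (at s)"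
    and "((\<lambda>s. E s \<bullet> U) has_real_derivative - (b * \<kappa> s) * (B s \<bullet> U)) (at s)"
proof -
  have U: "((\<lambda>_. U) has_vector_derivative 0) (at s)"
    by (rule has_vector_derivative_const)
  show "((\<lambda>s. T s \<bullet> U) has_real_derivative \<kappa> s * (N s \<bullet> U)) (at s)"
    using has_real_derivative_inner[OF T'[OF assms] U] by simp
  show "((\<lambda>s. N s \<bullet> U) has_real_derivative - \<kappa> s * (T s \<bullet> U) + a * \<kappa> s * (B s \<bullet> U)) (at s)"
    using has_real_derivative_inner[OF N'[OF assms] U] by (simp add: inner_diff_left inner_add_left)
  show "((\<lambda>s. B s \<bullet> U) has_real_derivative - (a * \<kappa> s) * (N s \<bullet> U) + b * \<kappa> s * (E s \<bullet> U)) (at s)"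
    using has_real_derivative_inner[OF B'[OF assms] U] by (simp add: inner_diff_left inner_add_left)
  show "((\<lambda>s. E s \<bullet> U) has_real_derivative - (b * \<kappa> s) * (B s \<bullet> U)) (at s)"
    using has_real_derivative_inner[OF E'[OF assms] U] by simp
qed

lemma derivative_of_constant:
  assumes "s \<in> I" "\<And>x. x \<in> I \<Longrightarrow> f x = c" "(f has_real_derivative D) (at s)"
  shows "D = 0"
  using DERIV_unique_on_open[OF I(1) assms(1,2,3), of 0] by simp

lemma orthogonal_to_frame_imp_0:
  assumes "s \<in> I" "T s \<bullet> U = 0" "N s \<bullet> U = 0" "B s \<bullet> U = 0" "E s \<bullet> U = 0"
  shows "U = 0"
  using orthonormal4_Parseval[OF frame[OF assms(1)], of U] assms(2-) by (simp add: inner_commute)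

text \<open>
  The chain of derivatives runs \<open>T \<rightarrow> N \<rightarrow> B \<rightarrow> E\<close>.  Constancy of the ratio \<open>a\<close> is what makes
  \<open>B \<bullet> U\<close> constant.
\<close>

lemma not_generalized_helix: "\<not> generalized_helix I T"
proof
  assume "generalized_helix I T"
  then obtain U c where U: "norm U = 1" and c: "\<And>s. s \<in> I \<Longrightarrow> T s \<bullet> U = c"
    unfolding generalized_helix_def
    by (rule constant_angle_imp_constant_inner) (use frame in \<open>auto simp: orthonormal4_def\<close>)
  have N0: "N s \<bullet> U = 0" if "s \<in> I" for s
    using derivative_of_constant[OF that c inner_frame_derivatives(1)[OF that]] \<kappa>0[OF that] by simp
  have Bc: "B s \<bullet> U = c / a" if "s \<in> I" for s
    using derivative_of_constant[OF that N0 inner_frame_derivatives(2)[OF that]] \<kappa>0[OF that] a0 c[OF that]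
    by (simp add: field_simps)
  have E0: "E s \<bullet> U = 0" if "s \<in> I" for s
    using derivative_of_constant[OF that Bc inner_frame_derivatives(3)[OF that]] \<kappa>0[OF that] b0 N0[OF that]
    by simp
  obtain s where s: "s \<in> I"
    using I(3) by blast
  have B0: "B s \<bullet> U = 0"
    using derivative_of_constant[OF s E0 inner_frame_derivatives(4)[OF s]] \<kappa>0[OF s] b0 by simp
  then have "T s \<bullet> U = 0"
    using Bc[OF s] c[OF s] a0 by simp
  then have "U = 0"
    using orthogonal_to_frame_imp_0 s N0 B0 E0 by blast
  with U show False
    by simp
qed

text \<open>
  The same chain in the order \<open>E \<rightarrow> B \<rightarrow> N \<rightarrow> T\<close>; here \<open>N \<bullet> U\<close> is constant because \<open>b / a\<close>
  is.
\<close>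

lemma not_slant_helix_type3: "\<not> slant_helix_type3 I E"
proof
  assume "slant_helix_type3 I E"
  then obtain U c where U: "norm U = 1" and c: "\<And>s. s \<in> I \<Longrightarrow> E s \<bullet> U = c"
    unfolding slant_helix_type3_def
    by (rule constant_angle_imp_constant_inner) (use frame in \<open>auto simp: orthonormal4_def\<close>)
  have B0: "B s \<bullet> U = 0" if "s \<in> I" for s
    using derivative_of_constant[OF that c inner_frame_derivatives(4)[OF that]] \<kappa>0[OF that] b0 by simp
  have Nc: "N s \<bullet> U = b * c / a" if "s \<in> I" for s
    using derivative_of_constant[OF that B0 inner_frame_derivatives(3)[OF that]] \<kappa>0[OF that] a0 c[OF that]
    by (simp add: field_simps)
  have T0: "T s \<bullet> U = 0" if "s \<in> I" for s
    using derivative_of_constant[OF that Nc inner_frame_derivatives(2)[OF that]] \<kappa>0[OF that] B0[OF that]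
    by simp
  obtain s where s: "s \<in> I"
    using I(3) by blast
  have N0: "N s \<bullet> U = 0"
    using derivative_of_constant[OF s T0 inner_frame_derivatives(1)[OF s]] \<kappa>0[OF s] by simp
  then have "E s \<bullet> U = 0"
    using Nc[OF s] c[OF s] a0 b0 by simp
  then have "U = 0"
    using orthogonal_to_frame_imp_0 s N0 B0 T0 by blast
  with U show False
    by simp
qed

section \<open>Coordinates of the center of a sphere\<close>

definition \<kappa>_deriv :: "nat \<Rightarrow> real \<Rightarrow> real" where
  "\<kappa>_deriv n = ((\<lambda>g s. vector_derivative g (at s)) ^^ n) \<kappa>"

text \<open>
  The functions \<open>cN\<close>, \<open>cB\<close>, \<open>cE\<close> are the coordinates, in the directions \<open>N\<close>, \<open>B\<close>, \<open>E\<close>, of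
  the vector from \<open>\<alpha>\<close> to the center of a sphere through the curve.  With \<open>f = 1 / \<kappa>\<^sup>2\<close> they are
  \<open>1 / \<kappa>\<close>, \<open>f' / (2 a)\<close> and \<open>(2 a\<^sup>2 + f'') / (2 a b \<kappa>)\<close>.  They are written as polynomials in
  \<open>1 / \<kappa>\<close> and the derivatives of \<open>\<kappa>\<close>, so that their derivatives can be computed without
  division; \<open>cE1\<close> and \<open>cE2\<close> are the first two derivatives of \<open>cE\<close>.
\<close>

definition cN :: "real \<Rightarrow> real" where
  "cN s = 1 / \<kappa> s"

definition cB :: "real \<Rightarrow> real" where
  "cB s = - \<kappa>_deriv 1 s * cN s ^ 3 / a"

definition cE :: "real \<Rightarrow> real" where
  "cE s = (a\<^sup>2 * cN s - \<kappa>_deriv 2 s * cN s ^ 4 + 3 * (\<kappa>_deriv 1 s)\<^sup>2 * cN s ^ 5) / (a * b)"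

definition cE1 :: "real \<Rightarrow> real" where
  "cE1 s = (- a\<^sup>2 * \<kappa>_deriv 1 s * (cN s)\<^sup>2 - \<kappa>_deriv 3 s * cN s ^ 4 + 10 * \<kappa>_deriv 1 s * \<kappa>_deriv 2 s * cN s ^ 5
     - 15 * \<kappa>_deriv 1 s ^ 3 * cN s ^ 6) / (a * b)"

definition cE2 :: "real \<Rightarrow> real" where
  "cE2 s = (- a\<^sup>2 * \<kappa>_deriv 2 s * (cN s)\<^sup>2 + 2 * a\<^sup>2 * (\<kappa>_deriv 1 s)\<^sup>2 * cN s ^ 3
     - \<kappa>_deriv 4 s * cN s ^ 4 + 14 * \<kappa>_deriv 1 s * \<kappa>_deriv 3 s * cN s ^ 5 + 10 * (\<kappa>_deriv 2 s)\<^sup>2 * cN s ^ 5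
     - 95 * (\<kappa>_deriv 1 s)\<^sup>2 * \<kappa>_deriv 2 s * cN s ^ 6 + 90 * \<kappa>_deriv 1 s ^ 4 * cN s ^ 7) / (a * b)"

lemma \<kappa>_cN: "s \<in> I \<Longrightarrow> \<kappa> s * cN s = 1"
  using \<kappa>0 by (simp add: cN_def)

lemma \<kappa>_deriv': "s \<in> I \<Longrightarrow> (\<kappa>_deriv n has_real_derivative \<kappa>_deriv (Suc n) s) (at s)"
  unfolding \<kappa>_deriv_def by (rule smooth_on_open_has_derivative[OF \<kappa>_smooth I(1)])

lemma \<kappa>_deriv'_numeral:
  assumes "s \<in> I"
  shows "(\<kappa>_deriv 1 has_real_derivative \<kappa>_deriv 2 s) (at s)"
    and "(\<kappa>_deriv 2 has_real_derivative \<kappa>_deriv 3 s) (at s)"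
    and "(\<kappa>_deriv 3 has_real_derivative \<kappa>_deriv 4 s) (at s)"
  using \<kappa>_deriv'[OF assms, of 1] \<kappa>_deriv'[OF assms, of 2] \<kappa>_deriv'[OF assms, of 3]
  by (simp_all add: eval_nat_numeral)

lemma \<kappa>': "s \<in> I \<Longrightarrow> (\<kappa> has_real_derivative \<kappa>_deriv 1 s) (at s)"
  using \<kappa>_deriv'[of s 0] by (simp add: \<kappa>_deriv_def)

lemma cN'_\<kappa>_deriv:
  assumes "s \<in> I"
  shows "(cN has_real_derivative - \<kappa>_deriv 1 s * (cN s)\<^sup>2) (at s)"
proof -
  have "((\<lambda>s. 1 / \<kappa> s) has_real_derivative - \<kappa>_deriv 1 s * (1 / \<kappa> s)\<^sup>2) (at s)"
    using \<kappa>0[OF assms]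
    by (auto intro!: derivative_eq_intros \<kappa>' assms simp: power2_eq_square)
  then show ?thesis
    by (simp add: cN_def[abs_def])
qed

text \<open>
  The two derivatives below and \<open>\<kappa> cN = 1\<close> say that the \<open>T\<close>, \<open>N\<close> and \<open>B\<close>
  components of the derivative of \<open>\<alpha> + cN N + cB B + cE E\<close> vanish.
\<close>

lemma cN': "s \<in> I \<Longrightarrow> (cN has_real_derivative a * \<kappa> s * cB s) (at s)"
proof -
  assume s: "s \<in> I"
  have "a * \<kappa> s * cB s = - \<kappa>_deriv 1 s * (cN s)\<^sup>2"
    using \<kappa>_cN[OF s] a0 \<kappa>0[OF s] by (simp add: cB_def cN_def field_simps eval_nat_numeral)
  then show ?thesis
    using cN'_\<kappa>_deriv[OF s] by simp
qed

lemma cB':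
  assumes s: "s \<in> I"
  shows "(cB has_real_derivative b * \<kappa> s * cE s - a) (at s)"
proof -
  have "(cB has_real_derivative (- \<kappa>_deriv 2 s * cN s ^ 3 + 3 * (\<kappa>_deriv 1 s)\<^sup>2 * cN s ^ 4) / a) (at s)"
    unfolding cB_def[abs_def]
    by (rule DERIV_cdivide, (rule derivative_eq_intros cN'_\<kappa>_deriv \<kappa>_deriv'_numeral s refl)+)
      (simp add: algebra_simps eval_nat_numeral)
  moreover have "b * \<kappa> s * cE s - a = (- \<kappa>_deriv 2 s * cN s ^ 3 + 3 * (\<kappa>_deriv 1 s)\<^sup>2 * cN s ^ 4) / a"
    using a0 b0 \<kappa>0[OF s] by (simp add: cE_def cN_def field_simps eval_nat_numeral)
  ultimately show ?thesis
    by simp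
qed

lemma cE':
  assumes s: "s \<in> I"
  shows "(cE has_real_derivative cE1 s) (at s)"
  unfolding cE_def[abs_def] cE1_def
  by (rule DERIV_cdivide, (rule derivative_eq_intros cN'_\<kappa>_deriv \<kappa>_deriv'_numeral s refl)+)
    (simp add: algebra_simps eval_nat_numeral)

lemma cE1':
  assumes s: "s \<in> I"
  shows "(cE1 has_real_derivative cE2 s) (at s)"
  unfolding cE1_def[abs_def] cE2_def
  by (rule DERIV_cdivide, (rule derivative_eq_intros cN'_\<kappa>_deriv \<kappa>_deriv'_numeral s refl)+)
    (simp add: algebra_simps eval_nat_numeral)

lemma continuous_on_cE2: "continuous_on I cE2"
proof -
  have \<kappa>_deriv: "continuous_on I (\<kappa>_deriv n)" for n
    using \<kappa>_deriv' DERIV_isCont continuous_at_imp_continuous_on by blast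
  have cN: "continuous_on I cN"
    using cN' DERIV_isCont continuous_at_imp_continuous_on by blast
  show ?thesis
    unfolding cE2_def[abs_def] using a0 b0 by (intro continuous_intros \<kappa>_deriv cN) auto
qed

lemma deriv_f:
  assumes "s \<in> I"
  shows "deriv (\<lambda>s. 1 / (\<kappa> s)\<^sup>2) s = 2 * a * cB s"
proof -
  have "((\<lambda>s. (cN s)\<^sup>2) has_real_derivative 2 * a * cB s) (at s)"
    using \<kappa>_cN[OF assms] by (auto intro!: derivative_eq_intros cN' assms)
  then have "((\<lambda>s. 1 / (\<kappa> s)\<^sup>2) has_real_derivative 2 * a * cB s) (at s)"
    by (simp add: cN_def power_divide)
  then show ?thesis
    by (rule DERIV_imp_deriv)
qed

lemma deriv_deriv_f:
  assumes "s \<in> I"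
  shows "2 * a\<^sup>2 + deriv (deriv (\<lambda>s. 1 / (\<kappa> s)\<^sup>2)) s = 2 * a * b * \<kappa> s * cE s"
proof -
  have "((\<lambda>s. 2 * a * cB s) has_real_derivative 2 * a * (b * \<kappa> s * cE s - a)) (at s)"
    by (intro DERIV_cmult cB' assms)
  then have "(deriv (\<lambda>s. 1 / (\<kappa> s)\<^sup>2) has_real_derivative 2 * a * (b * \<kappa> s * cE s - a)) (at s)"
    by (rule has_field_derivative_transform_within_open[OF _ I(1) assms]) (simp add: deriv_f)
  then show ?thesis
    by (simp add: DERIV_imp_deriv algebra_simps power2_eq_square)
qed

lemma radius_expression:
  assumes "s \<in> I"
  shows "1 / (\<kappa> s)\<^sup>2 + (deriv (\<lambda>s. 1 / (\<kappa> s)\<^sup>2) s)\<^sup>2 / (4 * a\<^sup>2)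
      + 1 / (\<kappa> s)\<^sup>2 / (4 * a\<^sup>2 * b\<^sup>2) * (2 * a\<^sup>2 + deriv (deriv (\<lambda>s. 1 / (\<kappa> s)\<^sup>2)) s)\<^sup>2
    = (cN s)\<^sup>2 + (cB s)\<^sup>2 + (cE s)\<^sup>2"
  unfolding deriv_deriv_f[OF assms] deriv_f[OF assms]
  using a0 b0 \<kappa>0[OF assms] by (simp add: cN_def power_mult_distrib power_divide)

section \<open>Spherical curves and the radius equation\<close>

text \<open>
  For a sphere with center \<open>m\<close>, the components of \<open>x = \<alpha> - m\<close> are found one after the other:
  \<open>x \<bullet> x\<close> is constant, so \<open>x \<bullet> T = 0\<close>, and differentiating each component gives the next,
  until all of \<open>x\<close> is known and Parseval's identity yields the equation.
\<close>

lemma spherical_imp_radius: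
  assumes "on_hypersphere I \<alpha> r" "s \<in> I"
  shows "(cN s)\<^sup>2 + (cB s)\<^sup>2 + (cE s)\<^sup>2 = r\<^sup>2"
proof -
  obtain m where "\<alpha> ` I \<subseteq> sphere m r"
    using assms(1) by (auto simp: on_hypersphere_def)
  then have m: "dist m (\<alpha> s) = r" if "s \<in> I" for s
    using that by auto
  define x where "x = (\<lambda>s. \<alpha> s - m)"
  have x': "(x has_vector_derivative T s) (at s)" if "s \<in> I" for s
    unfolding x_def using has_vector_derivative_diff[OF \<alpha>'[OF that] has_vector_derivative_const[of m]]
    by simp
  have xx: "x s \<bullet> x s = r\<^sup>2" if "s \<in> I" for s
    using m[OF that] by (simp add: x_def dist_norm norm_minus_commute flip: power2_norm_eq_inner)
  have on: "T s \<bullet> T s = 1" "N s \<bullet> T s = 0" "B s \<bullet> T s = 0" "E s \<bullet> T s = 0" if "s \<in> I" for s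
    using frame[OF that] by (auto simp: orthonormal4_def norm_eq_1 inner_commute)
  have xT: "T s \<bullet> x s = 0" if "s \<in> I" for s
    using derivative_of_constant[OF that xx has_real_derivative_inner[OF x' x']] that
    by (simp add: inner_commute)
  have xN: "N s \<bullet> x s = - cN s" if "s \<in> I" for s
    using derivative_of_constant[OF that xT has_real_derivative_inner[OF T' x']] on[OF that] that \<kappa>0[OF that]
    by (simp add: cN_def field_simps)
  have xB: "B s \<bullet> x s = - cB s" if s: "s \<in> I" for s
  proof -
    have "((\<lambda>s. - cN s) has_real_derivative - (a * \<kappa> s * cB s)) (at s)"
      by (intro DERIV_minus cN' s)
    from DERIV_unique_on_open[OF I(1) s xN has_real_derivative_inner[OF N' x'] this] s
    have "a * \<kappa> s * (B s \<bullet> x s + cB s) = 0"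
      using on[OF s] xT[OF s] by (simp add: inner_add_left inner_diff_left algebra_simps)
    then show ?thesis
      using a0 \<kappa>0[OF s] by simp
  qed
  have xE: "E s \<bullet> x s = - cE s" if s: "s \<in> I" for s
  proof -
    have "((\<lambda>s. - cB s) has_real_derivative - (b * \<kappa> s * cE s - a)) (at s)"
      by (intro DERIV_minus cB' s)
    from DERIV_unique_on_open[OF I(1) s xB has_real_derivative_inner[OF B' x'] this] s
    have "b * \<kappa> s * (E s \<bullet> x s + cE s) = 0"
      using on[OF s] xN[OF s] \<kappa>_cN[OF s]
      by (simp add: inner_add_left inner_diff_left algebra_simps)
    then show ?thesis
      using b0 \<kappa>0[OF s] by simp
  qed
  have "x s \<bullet> x s = (x s \<bullet> T s)\<^sup>2 + (x s \<bullet> N s)\<^sup>2 + (x s \<bullet> B s)\<^sup>2 + (x s \<bullet> E s)\<^sup>2"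
    by (rule orthonormal4_Parseval[OF frame[OF assms(2)]])
  then show ?thesis
    using xx xT xN xB xE assms(2) by (simp add: inner_commute)
qed

text \<open>The only possible center of a sphere containing the curve, as computed at \<open>s\<close>.\<close>

definition center :: "real \<Rightarrow> real^4" where
  "center s = \<alpha> s + cN s *\<^sub>R N s + cB s *\<^sub>R B s + cE s *\<^sub>R E s"

lemma center':
  assumes s: "s \<in> I"
  shows "(center has_vector_derivative (cE1 s + b * \<kappa> s * cB s) *\<^sub>R E s) (at s)"
proof -
  have "(center has_vector_derivative
      T s + (cN s *\<^sub>R (- \<kappa> s *\<^sub>R T s + (a * \<kappa> s) *\<^sub>R B s) + (a * \<kappa> s * cB s) *\<^sub>R N s)
      + (cB s *\<^sub>R (- (a * \<kappa> s) *\<^sub>R N s + (b * \<kappa> s) *\<^sub>R E s) + (b * \<kappa> s * cE s - a) *\<^sub>R B s)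
      + (cE s *\<^sub>R (- (b * \<kappa> s) *\<^sub>R B s) + cE1 s *\<^sub>R E s)) (at s)" (is "(_ has_vector_derivative ?D) _")
    unfolding center_def[abs_def]
    by (intro has_vector_derivative_add has_vector_derivative_scaleR \<alpha>' N' B' E' cN' cB' cE' s)
  also have "?D = (1 - \<kappa> s * cN s) *\<^sub>R T s + (a * (\<kappa> s * cN s) - a) *\<^sub>R B s
      + (cE1 s + b * \<kappa> s * cB s) *\<^sub>R E s"
    by (simp add: algebra_simps)
  finally show ?thesis
    using \<kappa>_cN[OF s] by simp
qed

text \<open>
  Since \<open>\<kappa> cN = 1\<close>, the terms \<open>a cB\<close> coming from \<open>cN cN'\<close> and \<open>cB cB'\<close> cancel, and \<open>cE\<close>
  factors out of what remains.  The other factor is the one in the derivative of the center.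
\<close>

lemma radius_derivative:
  assumes "\<And>s. s \<in> I \<Longrightarrow> (cN s)\<^sup>2 + (cB s)\<^sup>2 + (cE s)\<^sup>2 = c" "s \<in> I"
  shows "cE s * (cE1 s + b * \<kappa> s * cB s) = 0"
proof -
  have "((\<lambda>s. (cN s)\<^sup>2 + (cB s)\<^sup>2 + (cE s)\<^sup>2) has_real_derivative
      2 * cN s * (a * \<kappa> s * cB s) + 2 * cB s * (b * \<kappa> s * cE s - a) + 2 * cE s * cE1 s) (at s)"
    by (auto intro!: derivative_eq_intros cN' cB' cE' assms)
  from derivative_of_constant[OF assms(2) assms(1) this]
  have "2 * a * cB s * (\<kappa> s * cN s - 1) + 2 * (cE s * (cE1 s + b * \<kappa> s * cB s)) = 0"
    by (simp add: algebra_simps)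
  then show ?thesis
    using \<kappa>_cN[OF assms(2)] by simp
qed

text \<open>
  If \<open>cE\<close> is not identically zero, the rigidity lemma makes the center stationary, hence constant
  on the interval; its distance from the curve is read off in the orthonormal frame.
\<close>

lemma radius_imp_spherical:
  assumes r: "r > 0"
    and radius: "\<And>s. s \<in> I \<Longrightarrow> (cN s)\<^sup>2 + (cB s)\<^sup>2 + (cE s)\<^sup>2 = r\<^sup>2"
    and nontrivial: "\<exists>s\<in>I. cE s \<noteq> 0"
  shows "on_hypersphere I \<alpha> r"
proof -
  have "\<forall>s\<in>I. cE1 s + b * \<kappa> s * cB s = 0"
    using factor_vanishes_or_trivial[OF I(1,2) cE' cE1' continuous_on_cE2 _ \<kappa>0 cB' a0 b0
        radius_derivative[OF radius]] \<kappa>' nontrivial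
    by (auto simp: real_differentiable_def)
  then have center'0: "(center has_derivative (\<lambda>_. 0)) (at s)" if "s \<in> I" for s
    using center'[OF that] that by (simp add: has_vector_derivative_def)
  have "convex I"
    using I(2) by (simp add: is_interval_connected_1[symmetric] is_interval_convex_1)
  then obtain m where m: "\<And>s. s \<in> I \<Longrightarrow> center s = m"
    using has_derivative_zero_constant[OF _ has_derivative_at_withinI[OF center'0]] by metis
  have "dist m (\<alpha> s) = r" if s: "s \<in> I" for s
  proof -
    define x where "x = m - \<alpha> s"
    have x: "x = cN s *\<^sub>R N s + cB s *\<^sub>R B s + cE s *\<^sub>R E s"
      unfolding x_def m[OF s, symmetric] center_def by simp
    have "x \<bullet> x = (cN s)\<^sup>2 + (cB s)\<^sup>2 + (cE s)\<^sup>2"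
      using frame[OF s] unfolding x
      by (simp add: orthonormal4_def norm_eq_1 inner_add_left inner_add_right inner_commute
          power2_eq_square)
    then have "(norm x)\<^sup>2 = r\<^sup>2"
      using radius[OF s] by (simp add: power2_norm_eq_inner)
    then show ?thesis
      using r by (simp add: dist_norm x_def)
  qed
  then have "\<alpha> ` I \<subseteq> sphere m r"
    by auto
  then show ?thesis
    by (auto simp: on_hypersphere_def)
qed

text \<open>
  With \<open>cE = 0\<close> the derivative of \<open>cB\<close> is \<open>- a\<close>, so \<open>cB\<close> is affine and nonconstant, while
  the radius equation bounds its absolute value by \<open>\<bar>r\<bar>\<close>.
\<close>

lemma bounded_if_trivial:
  assumes radius: "\<And>s. s \<in> I \<Longrightarrow> (cN s)\<^sup>2 + (cB s)\<^sup>2 + (cE s)\<^sup>2 = r\<^sup>2"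
    and h0: "\<And>s. s \<in> I \<Longrightarrow> cE s = 0"
  shows "bounded I"
proof -
  have const: "((\<lambda>s. cB s + a * s) has_real_derivative 0) (at s)" if "s \<in> I" for s
    using h0[OF that] by (auto intro!: derivative_eq_intros cB' that)
  have "convex I"
    using I(2) by (simp add: is_interval_connected_1[symmetric] is_interval_convex_1)
  then obtain c where c: "\<And>s. s \<in> I \<Longrightarrow> cB s + a * s = c"
    using has_field_derivative_zero_constant[OF _ has_field_derivative_at_within[OF const]] by metis
  have "norm s \<le> (\<bar>c\<bar> + \<bar>r\<bar>) / \<bar>a\<bar>" if s: "s \<in> I" for s
  proof -
    have "(cB s)\<^sup>2 \<le> r\<^sup>2"
      using radius[OF s] by (smt (verit) zero_le_power2)
    then have "\<bar>cB s\<bar> \<le> \<bar>r\<bar>"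
      by (simp add: abs_le_square_iff)
    then have "\<bar>a * s\<bar> \<le> \<bar>c\<bar> + \<bar>r\<bar>"
      using c[OF s] by linarith
    then show ?thesis
      using a0 by (simp add: abs_mult field_simps)
  qed
  then show ?thesis
    by (rule boundedI)
qed

end

theorem theorem3p5:
  fixes I :: "real set"
    and \<alpha> T N B E :: "real \<Rightarrow> real^4"
    and \<kappa> \<tau> \<sigma> :: "real \<Rightarrow> real"
    and a b :: real
  assumes "ccr_curve I \<alpha> T N B E \<kappa> \<tau> \<sigma>"
    and "\<forall>s\<in>I. \<kappa> s \<noteq> 0 \<and> \<tau> s \<noteq> 0 \<and> \<sigma> s \<noteq> 0"
    and "\<forall>s\<in>I. \<tau> s = a * \<kappa> s"
    and "\<forall>s\<in>I. \<sigma> s = b * \<kappa> s"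
  shows "\<not> generalized_helix I T \<and>
    \<not> slant_helix_type3 I E \<and>
    (\<forall>r>0.
      let f = (\<lambda>s. 1 / (\<kappa> s)\<^sup>2);
          f' = deriv f;
          f'' = deriv f';
          radius_equation =
            (\<forall>s\<in>I. f s + (f' s)\<^sup>2 / (4 * a\<^sup>2)
               + f s / (4 * a\<^sup>2 * b\<^sup>2) * (2 * a\<^sup>2 + f'' s)\<^sup>2 = r\<^sup>2)
      in (on_hypersphere I \<alpha> r \<longrightarrow> radius_equation) \<and>
         (\<not> bounded I \<or> (\<exists>s\<in>I. 2 * a\<^sup>2 + f'' s \<noteq> 0) \<longrightarrow>
            (on_hypersphere I \<alpha> r \<longleftrightarrow> radius_equation)))"
proof -
  have curve: "unit_speed_frenet_curve I \<alpha> T N B E \<kappa> \<tau> \<sigma>"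
    using assms(1) by (simp add: ccr_curve_def)
  have "I \<noteq> {}"
    using curve by (simp add: unit_speed_frenet_curve_def)
  then have ab: "a \<noteq> 0" "b \<noteq> 0"
    using assms(2-4) by fastforce+
  interpret ccr_frenet I \<alpha> T N B E \<kappa> a b
    using curve assms(2-4) ab
    by unfold_locales
      (auto simp: unit_speed_frenet_curve_def is_interval_connected_1)
  define f where "f = (\<lambda>s. 1 / (\<kappa> s)\<^sup>2)"
  have equation: "f s + (deriv f s)\<^sup>2 / (4 * a\<^sup>2)
      + f s / (4 * a\<^sup>2 * b\<^sup>2) * (2 * a\<^sup>2 + deriv (deriv f) s)\<^sup>2 = (cN s)\<^sup>2 + (cB s)\<^sup>2 + (cE s)\<^sup>2"
    if "s \<in> I" for s
    using radius_expression[OF that] unfolding f_def .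
  have nontrivial: "2 * a\<^sup>2 + deriv (deriv f) s \<noteq> 0 \<longleftrightarrow> cE s \<noteq> 0" if "s \<in> I" for s
    using deriv_deriv_f[OF that] ab \<kappa>0[OF that] by (simp add: f_def)
  have radius: "(\<forall>s\<in>I. f s + (deriv f s)\<^sup>2 / (4 * a\<^sup>2)
      + f s / (4 * a\<^sup>2 * b\<^sup>2) * (2 * a\<^sup>2 + deriv (deriv f) s)\<^sup>2 = r\<^sup>2)
    \<longleftrightarrow> (\<forall>s\<in>I. (cN s)\<^sup>2 + (cB s)\<^sup>2 + (cE s)\<^sup>2 = r\<^sup>2)" for r
    using equation by (intro ball_cong) simp_all
  have sphere: "on_hypersphere I \<alpha> r \<longrightarrow> (\<forall>s\<in>I. (cN s)\<^sup>2 + (cB s)\<^sup>2 + (cE s)\<^sup>2 = r\<^sup>2)" for r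
    using spherical_imp_radius by blast
  have converse: "on_hypersphere I \<alpha> r \<longleftrightarrow> (\<forall>s\<in>I. (cN s)\<^sup>2 + (cB s)\<^sup>2 + (cE s)\<^sup>2 = r\<^sup>2)"
    if "r > 0" "\<not> bounded I \<or> (\<exists>s\<in>I. cE s \<noteq> 0)" for r
    using that sphere radius_imp_spherical[of r] bounded_if_trivial[of r] by blast
  have "(\<exists>s\<in>I. 2 * a\<^sup>2 + deriv (deriv f) s \<noteq> 0) \<longleftrightarrow> (\<exists>s\<in>I. cE s \<noteq> 0)"
    using nontrivial by blast
  then show ?thesis
    unfolding Let_def f_def[symmetric] radius
    using not_generalized_helix not_slant_helix_type3 sphere converse by blast
qed

end
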